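(* Let $(X_i)_{i\in I}$ be a family of topological spaces, $X=\coprod_{i\in I}X_i$ their topological sum, and let $\Theta:\mathcal O(X)\to\prod_{i\in I}\mathcal O(X_i)$, $\Theta(U)=(U\cap X_i)_{i\in I}$, be the canonical frame isomorphism. (1) If $X$ is consonant, then $\Theta$ is a homeomorphism $\Sigma\mathcal O(X)\to\prod_{i\in I}\Sigma\mathcal O(X_i)$ (topological product on the right). Equivalently, $$\sigma\Big(\prod_{i\in I}\mathcal O(X_i)\Big)=\prod_{i\in I}\sigma(\mathcal O(X_i)).\qquad( * )$$ (2) If every $X_i$ is consonant and $( * )$ holds, then $X$ is consonant. Consequently, for a family of consonant spaces $X_i$, the identity $( * )$ holds if and only if their topological sum $\coprod_{i\in I} X_i$ is consonant.
   Context: $\mathcal O(X)$ is the lattice of open subsets of $X$ ordered by inclusion. For a poset $P$, a subset $U$ is Scott open if it is an upper set and every directed set $D$ having a supremum $\bigvee D\in U$ meets $U$ (directed sets are nonempty); $\sigma(P)$ is the Scott topology and $\Sigma P=(P,\sigma(P))$. In $( * )$ the left-hand side is the Scott topology of the coordinatewise order and the right-hand side is the product topology. A subset of a space is saturated if it is an intersection of open sets; compactness does not include any separation axiom. For compact saturated $K\subseteq X$ put $\Phi_X(K)=\{U\in\mathcal O(X):K\subseteq U\}$. A space $X$ is consonant if for every Scott-open $\mathcal H\subseteq\mathcal O(X)$ and every $U\in\mathcal H$ there is a compact saturated set $K\subseteq U$ (possibly empty) with $U\in\Phi_X(K)\subseteq\mathcal H$. *)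

theory Defs
  imports "HOL-Analysis.Analysis"
begin

text \<open>A poset is given by a carrier set \<open>P\<close> and an order relation \<open>le\<close>, of which only the
  restriction to \<open>P\<close> matters.\<close>

definition directed_in :: "'a set \<Rightarrow> ('a \<Rightarrow> 'a \<Rightarrow> bool) \<Rightarrow> 'a set \<Rightarrow> bool" where
  "directed_in P le D \<longleftrightarrow>
     D \<subseteq> P \<and> D \<noteq> {} \<and> (\<forall>x\<in>D. \<forall>y\<in>D. \<exists>z\<in>D. le x z \<and> le y z)"

definition is_sup_in :: "'a set \<Rightarrow> ('a \<Rightarrow> 'a \<Rightarrow> bool) \<Rightarrow> 'a set \<Rightarrow> 'a \<Rightarrow> bool" where
  "is_sup_in P le D s \<longleftrightarrow>
     s \<in> P \<and> (\<forall>x\<in>D. le x s) \<and> (\<forall>u\<in>P. (\<forall>x\<in>D. le x u) \<longrightarrow> le s u)"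

definition scott_open :: "'a set \<Rightarrow> ('a \<Rightarrow> 'a \<Rightarrow> bool) \<Rightarrow> 'a set \<Rightarrow> bool" where
  "scott_open P le U \<longleftrightarrow>
     U \<subseteq> P \<and> (\<forall>x\<in>U. \<forall>y\<in>P. le x y \<longrightarrow> y \<in> U) \<and>
     (\<forall>D s. directed_in P le D \<and> is_sup_in P le D s \<and> s \<in> U \<longrightarrow> D \<inter> U \<noteq> {})"

definition scott_topology :: "'a set \<Rightarrow> ('a \<Rightarrow> 'a \<Rightarrow> bool) \<Rightarrow> 'a topology" where
  "scott_topology P le = topology (scott_open P le)"

lemma scott_open_meets_directed:
  assumes "scott_open P le U" "directed_in P le D" "is_sup_in P le D s" "s \<in> U"
  shows "D \<inter> U \<noteq> {}"
  using assms(1)[unfolded scott_open_def, THEN conjunct2, THEN conjunct2, rule_format, of D s]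
    assms(2-4) by simp

lemma istopology_scott_open: "istopology (scott_open P le)"
proof -
  have "scott_open P le (S \<inter> T)" if S: "scott_open P le S" and T: "scott_open P le T" for S T
    unfolding scott_open_def
  proof (intro conjI allI impI)
    show "S \<inter> T \<subseteq> P" "\<forall>x\<in>S \<inter> T. \<forall>y\<in>P. le x y \<longrightarrow> y \<in> S \<inter> T"
      using S T by (auto simp: scott_open_def)
    fix D s assume D: "directed_in P le D \<and> is_sup_in P le D s \<and> s \<in> S \<inter> T"
    have "D \<inter> U \<noteq> {}" if "scott_open P le U" "s \<in> U" for U
      by (rule scott_open_meets_directed) (use that D in auto)
    then obtain x y where xy: "x \<in> D" "x \<in> S" "y \<in> D" "y \<in> T"
      using S T D by (metis IntD1 IntD2 disjoint_iff)
    have "\<forall>x\<in>D. \<forall>y\<in>D. \<exists>z\<in>D. le x z \<and> le y z"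
      using D by (simp add: directed_in_def)
    with xy obtain z where z: "z \<in> D" "le x z" "le y z"
      by meson
    moreover have "z \<in> P"
      using D z by (auto simp: directed_in_def)
    ultimately have "z \<in> S" "z \<in> T"
      using S T xy by (auto simp: scott_open_def)
    with z show "D \<inter> (S \<inter> T) \<noteq> {}"
      by auto
  qed
  moreover have "scott_open P le (\<Union>\<K>)" if \<K>: "\<forall>K\<in>\<K>. scott_open P le K" for \<K>
    unfolding scott_open_def
  proof (intro conjI allI impI)
    show "\<Union>\<K> \<subseteq> P" "\<forall>x\<in>\<Union>\<K>. \<forall>y\<in>P. le x y \<longrightarrow> y \<in> \<Union>\<K>"
      using \<K> by (auto simp: scott_open_def)
    fix D s assume D: "directed_in P le D \<and> is_sup_in P le D s \<and> s \<in> \<Union>\<K>"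
    then obtain K where K: "K \<in> \<K>" "s \<in> K"
      by auto
    then have "D \<inter> K \<noteq> {}"
      using \<K> D by (intro scott_open_meets_directed) auto
    with K show "D \<inter> \<Union>\<K> \<noteq> {}"
      by auto
  qed
  ultimately show ?thesis
    by (simp add: istopology_def)
qed

lemma openin_scott_topology [simp]: "openin (scott_topology P le) U \<longleftrightarrow> scott_open P le U"
  by (simp add: scott_topology_def istopology_scott_open)

lemma topspace_scott_topology [simp]: "topspace (scott_topology P le) = P"
proof
  show "topspace (scott_topology P le) \<subseteq> P"
    using openin_topspace[of "scott_topology P le"] by (simp only: openin_scott_topology scott_open_def)
  have "scott_open P le P"
    by (auto simp: scott_open_def directed_in_def)
  then show "P \<subseteq> topspace (scott_topology P le)"
    by (metis openin_scott_topology openin_subset)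
qed

abbreviation opens_of :: "'a topology \<Rightarrow> 'a set set" where
  "opens_of X \<equiv> {U. openin X U}"

abbreviation scott_opens :: "'a topology \<Rightarrow> 'a set topology" where
  "scott_opens X \<equiv> scott_topology (opens_of X) (\<subseteq>)"

text \<open>Intersecting with \<^term>\<open>topspace X\<close> makes the empty intersection equal to the whole space
  (rather than \<^term>\<open>UNIV\<close>).\<close>

definition saturatedin :: "'a topology \<Rightarrow> 'a set \<Rightarrow> bool" where
  "saturatedin X K \<longleftrightarrow> (\<exists>\<U>. (\<forall>U\<in>\<U>. openin X U) \<and> K = topspace X \<inter> \<Inter>\<U>)"

definition open_nhds_of :: "'a topology \<Rightarrow> 'a set \<Rightarrow> 'a set set" where
  "open_nhds_of X K = {U. openin X U \<and> K \<subseteq> U}"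

definition consonant_space :: "'a topology \<Rightarrow> bool" where
  "consonant_space X \<longleftrightarrow>
     (\<forall>\<H>. openin (scott_opens X) \<H> \<longrightarrow>
       (\<forall>U\<in>\<H>. \<exists>K. compactin X K \<and> saturatedin X K \<and> K \<subseteq> U \<and>
                   U \<in> open_nhds_of X K \<and> open_nhds_of X K \<subseteq> \<H>))"

text \<open>Elements of \<^term>\<open>PiE I A\<close> are functions that are \<^term>\<open>undefined\<close> outside \<open>I\<close>, so only the
  coordinates in \<open>I\<close> carry information.\<close>

definition coordinatewise_subset :: "'i set \<Rightarrow> ('i \<Rightarrow> 'a set) \<Rightarrow> ('i \<Rightarrow> 'a set) \<Rightarrow> bool" where
  "coordinatewise_subset I F G \<longleftrightarrow> (\<forall>i\<in>I. F i \<subseteq> G i)"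

text \<open>The summand \<open>X i\<close> sits inside \<^term>\<open>sum_topology X I\<close> as the set of pairs with first
  component \<open>i\<close>, so \<open>U \<inter> X i\<close> corresponds to the \<open>i\<close>-th slice of \<open>U\<close>.\<close>

definition sum_opens_map :: "'i set \<Rightarrow> ('i \<times> 'a) set \<Rightarrow> 'i \<Rightarrow> 'a set" where
  "sum_opens_map I U = (\<lambda>i\<in>I. {x. (i, x) \<in> U})"

lemma bij_betw_sum_opens_map:
  "bij_betw (sum_opens_map I) (opens_of (sum_topology X I)) (\<Pi>\<^sub>E i\<in>I. opens_of (X i))"
proof (rule bij_betw_byWitness[where f' = "Sigma I"])
  show "\<forall>U\<in>opens_of (sum_topology X I). Sigma I (sum_opens_map I U) = U"
  proof
    fix U assume "U \<in> opens_of (sum_topology X I)"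
    then have "U \<subseteq> Sigma I (topspace \<circ> X)"
      by (simp add: openin_sum_topology)
    then show "Sigma I (sum_opens_map I U) = U"
      by (auto simp: sum_opens_map_def)
  qed
  show "\<forall>F\<in>\<Pi>\<^sub>E i\<in>I. opens_of (X i). sum_opens_map I (Sigma I F) = F"
  proof
    fix F assume F: "F \<in> (\<Pi>\<^sub>E i\<in>I. opens_of (X i))"
    show "sum_opens_map I (Sigma I F) = F"
    proof
      show "sum_opens_map I (Sigma I F) i = F i" for i
        using PiE_arb[OF F, of i] by (cases "i \<in> I") (simp_all add: sum_opens_map_def)
    qed
  qed
  show "sum_opens_map I ` opens_of (sum_topology X I) \<subseteq> (\<Pi>\<^sub>E i\<in>I. opens_of (X i))"
    by (simp add: image_subset_iff openin_sum_topology sum_opens_map_def)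
  show "Sigma I ` (\<Pi>\<^sub>E i\<in>I. opens_of (X i)) \<subseteq> opens_of (sum_topology X I)"
    by (simp add: image_subset_iff openin_disjoint_union PiE_iff)
qed

lemma sum_opens_map_le_iff:
  assumes "openin (sum_topology X I) U" "openin (sum_topology X I) V"
  shows "coordinatewise_subset I (sum_opens_map I U) (sum_opens_map I V) \<longleftrightarrow> U \<subseteq> V"
proof -
  have "U \<subseteq> Sigma I (topspace \<circ> X)"
    using assms by (simp add: openin_sum_topology)
  then show ?thesis
    by (simp add: coordinatewise_subset_def sum_opens_map_def) blast
qed

end

theory Submission
  imports Defs
begin

text \<open>The map \<^const>\<open>sum_opens_map\<close> is an order isomorphism, hence a homeomorphism onto the Scott
  topology of the product order, so everything is about comparing that topology with the product
  topology, which is always coarser. A compact set in the sum meets only finitely many summands,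
  each in a compact set, so its open neighbourhoods form a basic open box in the product topology;
  consonance of the sum thus covers every Scott-open set by such boxes. Conversely, shrinking each
  of the finitely many proper sides of a box by consonance of the summand yields finitely many
  compact sets, whose union is compact in the sum.\<close>

section \<open>Scott topologies\<close>

lemma directed_in_image:
  assumes D: "directed_in P le D" and f: "f \<in> P \<rightarrow> Q"
    and mono: "\<And>x y. x \<in> P \<Longrightarrow> y \<in> P \<Longrightarrow> le x y \<Longrightarrow> le' (f x) (f y)"
  shows "directed_in Q le' (f ` D)"
proof -
  have "D \<subseteq> P" "D \<noteq> {}" and dir: "\<forall>x\<in>D. \<forall>y\<in>D. \<exists>z\<in>D. le x z \<and> le y z"
    using D by (simp_all add: directed_in_def)
  have "\<exists>z\<in>D. le' (f x) (f z) \<and> le' (f y) (f z)" if xy: "x \<in> D" "y \<in> D" for x y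
  proof -
    obtain z where "z \<in> D" "le x z" "le y z"
      using dir xy by blast
    then show ?thesis
      using mono \<open>D \<subseteq> P\<close> xy by (intro bexI[of _ z]) auto
  qed
  then show ?thesis
    using f \<open>D \<subseteq> P\<close> \<open>D \<noteq> {}\<close> unfolding directed_in_def by auto
qed

text \<open>Monotonicity makes the preimage of an upper set upper. If the sup of a directed
  \<open>D\<close> lies in the preimage of a Scott-open \<open>V\<close>, the image of
  \<open>D\<close> is directed with sup in \<open>V\<close>, so it meets \<open>V\<close>, and hence
  \<open>D\<close> meets the preimage.\<close>

lemma continuous_map_scott_topology:
  assumes f: "f \<in> P \<rightarrow> Q"
    and mono: "\<And>x y. x \<in> P \<Longrightarrow> y \<in> P \<Longrightarrow> le x y \<Longrightarrow> le' (f x) (f y)"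
    and sup: "\<And>D s. directed_in P le D \<Longrightarrow> is_sup_in P le D s \<Longrightarrow> is_sup_in Q le' (f ` D) (f s)"
  shows "continuous_map (scott_topology P le) (scott_topology Q le') f"
proof -
  have "scott_open P le {x \<in> P. f x \<in> V}" if V: "scott_open Q le' V" for V
    unfolding scott_open_def
  proof (intro conjI ballI allI impI)
    show "y \<in> {x \<in> P. f x \<in> V}" if "x \<in> {x \<in> P. f x \<in> V}" "y \<in> P" "le x y" for x y
    proof -
      have "le' (f x) (f y)" "f y \<in> Q" "f x \<in> V"
        using that mono f by auto
      then show ?thesis
        using V that(2) by (auto simp: scott_open_def)
    qed
    fix D s assume *: "directed_in P le D \<and> is_sup_in P le D s \<and> s \<in> {x \<in> P. f x \<in> V}"
    then have "directed_in Q le' (f ` D)"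
      using directed_in_image[where f = f and P = P and Q = Q and le = le and le' = le'] f mono by blast
    then have "f ` D \<inter> V \<noteq> {}"
      using scott_open_meets_directed[OF V] sup * by blast
    moreover have "D \<subseteq> P"
      using * by (simp add: directed_in_def)
    ultimately show "D \<inter> {x \<in> P. f x \<in> V} \<noteq> {}"
      by auto
  qed auto
  then show ?thesis
    using f by (auto simp: continuous_map_def)
qed

text \<open>Surjectivity writes any upper bound of the image as \<open>f v\<close>, and reflection
  of the order makes \<open>v\<close> an upper bound of \<open>D\<close>.\<close>

lemma is_sup_in_order_iso:
  assumes f: "bij_betw f P Q" and D: "D \<subseteq> P" and s: "is_sup_in P le D s"
    and le: "\<And>x y. x \<in> P \<Longrightarrow> y \<in> P \<Longrightarrow> le' (f x) (f y) \<longleftrightarrow> le x y"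
  shows "is_sup_in Q le' (f ` D) (f s)"
  unfolding is_sup_in_def
proof (intro conjI ballI impI)
  have sP: "s \<in> P"
    using s by (simp add: is_sup_in_def)
  show "f s \<in> Q"
    using f sP by (auto simp: bij_betw_def)
  show "le' y (f s)" if "y \<in> f ` D" for y
    using that D s le sP by (auto simp: is_sup_in_def)
  show "le' (f s) u" if u: "u \<in> Q" "\<forall>y\<in>f ` D. le' y u" for u
  proof -
    obtain v where v: "v \<in> P" "u = f v"
      using f u(1) by (auto simp: bij_betw_def)
    have "\<forall>x\<in>D. le x v"
      using u(2) v le D by auto
    then show ?thesis
      using s v le sP by (auto simp: is_sup_in_def)
  qed
qed

text \<open>An order isomorphism and its inverse both preserve order and sups, so both are Scott
  continuous.\<close>

lemma homeomorphic_map_scott_topology: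
  assumes f: "bij_betw f P Q"
    and le: "\<And>x y. x \<in> P \<Longrightarrow> y \<in> P \<Longrightarrow> le' (f x) (f y) \<longleftrightarrow> le x y"
  shows "homeomorphic_map (scott_topology P le) (scott_topology Q le') f"
proof -
  define g where "g = the_inv_into P f"
  have g: "bij_betw g Q P"
    unfolding g_def by (rule bij_betw_the_inv_into[OF f])
  have fg: "f (g y) = y" if "y \<in> Q" for y
    unfolding g_def by (rule f_the_inv_into_f_bij_betw[OF f]) (use that in auto)
  have gf: "g (f x) = x" if "x \<in> P" for x
    unfolding g_def using f that by (simp add: bij_betw_def the_inv_into_f_f)
  have gQ: "g y \<in> P" if "y \<in> Q" for y
    using g that by (rule bij_betwE[THEN bspec])
  have le_g: "le (g x) (g y) \<longleftrightarrow> le' x y" if "x \<in> Q" "y \<in> Q" for x y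
    using le[OF gQ gQ] fg that by metis
  have "continuous_map (scott_topology P le) (scott_topology Q le') f"
    using f le
    by (intro continuous_map_scott_topology is_sup_in_order_iso[OF f])
       (auto simp: bij_betw_def directed_in_def)
  moreover have "continuous_map (scott_topology Q le') (scott_topology P le) g"
    using g le_g
    by (intro continuous_map_scott_topology is_sup_in_order_iso[OF g])
       (auto simp: bij_betw_def directed_in_def)
  ultimately have "homeomorphic_maps (scott_topology P le) (scott_topology Q le') f g"
    using fg gf by (simp add: homeomorphic_maps_def)
  then show ?thesis
    by (rule homeomorphic_maps_imp_map)
qed

text \<open>A homeomorphism is a quotient map, so \<open>X\<close> and \<open>f\<close> determine
  the topology of the codomain. This turns the homeomorphism claim for \<open>sum_opens_map\<close>
  into an equality of two topologies.\<close>

lemma homeomorphic_map_same_domain_iff: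
  assumes "homeomorphic_map X Y f"
  shows "homeomorphic_map X Z f \<longleftrightarrow> Y = Z"
proof
  assume Z: "homeomorphic_map X Z f"
  have "openin T U \<longleftrightarrow> U \<subseteq> f ` topspace X \<and> openin X {x \<in> topspace X. f x \<in> U}"
    if "homeomorphic_map X T f" for T U
  proof -
    have "f ` topspace X = topspace T" "quotient_map X T f"
      using that by (simp_all add: homeomorphic_map_def quotient_map_def)
    then show ?thesis
      using openin_subset[of T U] unfolding quotient_map_def by blast
  qed
  with assms Z show "Y = Z"
    unfolding topology_eq by blast
qed (use assms in simp)

section \<open>Lattices of open sets\<close>

lemma is_sup_in_opens_of_iff:
  assumes "D \<subseteq> opens_of X"
  shows "is_sup_in (opens_of X) (\<subseteq>) D s \<longleftrightarrow> s = \<Union>D"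
proof -
  have "openin X (\<Union>D)"
    using assms by auto
  then show ?thesis
    by (auto simp: is_sup_in_def)
qed

text \<open>Compactness extracts a finite subcover from a directed open cover of \<open>K\<close>,
  and directedness gives one member containing all of it. This makes the sides of boxes built from
  compact sets Scott open.\<close>

lemma scott_open_open_nhds_of:
  assumes K: "compactin X K"
  shows "scott_open (opens_of X) (\<subseteq>) (open_nhds_of X K)"
  unfolding scott_open_def
proof (intro conjI ballI allI impI)
  show "open_nhds_of X K \<subseteq> opens_of X"
    by (auto simp: open_nhds_of_def)
  show "V \<in> open_nhds_of X K" if "U \<in> open_nhds_of X K" "V \<in> opens_of X" "U \<subseteq> V" for U V
    using that by (auto simp: open_nhds_of_def)
  fix D s
  assume *: "directed_in (opens_of X) (\<subseteq>) D \<and> is_sup_in (opens_of X) (\<subseteq>) D s \<and> s \<in> open_nhds_of X K"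
  then have D: "D \<subseteq> opens_of X" "D \<noteq> {}" and dir: "\<forall>x\<in>D. \<forall>y\<in>D. \<exists>z\<in>D. x \<subseteq> z \<and> y \<subseteq> z"
    by (simp_all add: directed_in_def)
  have "K \<subseteq> \<Union>D"
    using * is_sup_in_opens_of_iff[OF D(1)] by (auto simp: open_nhds_of_def)
  then obtain \<F> where \<F>: "finite \<F>" "\<F> \<subseteq> D" "K \<subseteq> \<Union>\<F>"
    using K D(1) unfolding compactin_def by (metis mem_Collect_eq subsetD)
  \<comment> \<open>The empty subfamily is bounded because directed sets are nonempty; the induction
    step is directedness.\<close>
  have "\<exists>z\<in>D. \<Union>\<F> \<subseteq> z"
    using \<F>(1,2)
  proof (induction \<F> rule: finite_induct)
    case empty
    then show ?case using D(2) by auto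
  next
    case (insert x \<F>)
    then obtain z where "z \<in> D" "\<Union>\<F> \<subseteq> z"
      by (meson insert_subset)
    moreover have "x \<in> D"
      using insert.prems by simp
    ultimately obtain w where "w \<in> D" "x \<subseteq> w" "z \<subseteq> w"
      using dir by meson
    with \<open>\<Union>\<F> \<subseteq> z\<close> show ?case
      by (intro bexI[of _ w]) simp_all
  qed
  then obtain z where "z \<in> D" "\<Union>\<F> \<subseteq> z"
    by (elim bexE)
  with \<F>(3) have "K \<subseteq> z"
    by (meson order_trans)
  moreover have "openin X z"
    using D(1) \<open>z \<in> D\<close> by auto
  ultimately have "z \<in> open_nhds_of X K"
    by (simp add: open_nhds_of_def)
  with \<open>z \<in> D\<close> show "D \<inter> open_nhds_of X K \<noteq> {}"
    by (meson disjoint_iff)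
qed

section \<open>Products of posets\<close>

lemma is_sup_in_PiE_component:
  assumes s: "is_sup_in (Pi\<^sub>E I P) (\<lambda>F G. \<forall>i\<in>I. le i (F i) (G i)) D s" and i: "i \<in> I"
  shows "is_sup_in (P i) (le i) ((\<lambda>F. F i) ` D) (s i)"
  unfolding is_sup_in_def
proof (intro conjI ballI impI)
  have sP: "s \<in> Pi\<^sub>E I P"
    using s by (simp add: is_sup_in_def)
  then show "s i \<in> P i"
    using i by auto
  show "le i x (s i)" if "x \<in> (\<lambda>F. F i) ` D" for x
    using that s i by (auto simp: is_sup_in_def)
  show "le i (s i) u" if u: "u \<in> P i" "\<forall>x\<in>(\<lambda>F. F i) ` D. le i x u" for u
  proof -
    \<comment> \<open>Changing only coordinate \<open>i\<close> of \<open>s\<close> to the bound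
      \<open>u\<close> gives another upper bound of \<open>D\<close> in the product, so
      \<open>s\<close> lies below it.\<close>
    have "s(i := u) \<in> Pi\<^sub>E I P"
      using sP u(1) i by (auto simp: PiE_iff extensional_def)
    moreover have "\<forall>F\<in>D. \<forall>j\<in>I. le j (F j) ((s(i := u)) j)"
      using s u(2) by (auto simp: is_sup_in_def)
    ultimately have "\<forall>j\<in>I. le j (s j) ((s(i := u)) j)"
      using s unfolding is_sup_in_def by blast
    then show ?thesis
      using i by (auto dest: bspec[of _ _ i])
  qed
qed

text \<open>Coordinate projections are monotone and preserve sups, hence are Scott continuous. The
  identity into the product topology is therefore continuous, and \<open>G\<close> is its own
  preimage.\<close>

lemma openin_scott_topology_PiE_if_openin_product:
  fixes P :: "'i \<Rightarrow> 'a set" and le :: "'i \<Rightarrow> 'a \<Rightarrow> 'a \<Rightarrow> bool"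
  assumes "openin (product_topology (\<lambda>i. scott_topology (P i) (le i)) I) G"
  shows "openin (scott_topology (Pi\<^sub>E I P) (\<lambda>F G. \<forall>i\<in>I. le i (F i) (G i))) G"
    (is "openin ?S G")
proof -
  have "continuous_map ?S (scott_topology (P i) (le i)) (\<lambda>F. F i)" if "i \<in> I" for i
    by (intro continuous_map_scott_topology is_sup_in_PiE_component) (use that in auto)
  then have "continuous_map ?S (product_topology (\<lambda>i. scott_topology (P i) (le i)) I) id"
    by (auto simp: continuous_map_componentwise PiE_iff)
  from openin_continuous_map_preimage[OF this assms]
  have "openin ?S {F \<in> topspace ?S. id F \<in> G}" .
  moreover have "{F \<in> topspace ?S. id F \<in> G} = G"
    using openin_subset[OF assms] by auto
  ultimately show ?thesis
    by (simp only:)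
qed

section \<open>Compact and saturated sets in topological sums\<close>

text \<open>The summands are disjoint clopen copies of the \<open>X i\<close>. Finitely many of them
  cover a compact \<open>K\<close>, and closedness makes each trace of \<open>K\<close> compact.
  Conversely, \<open>K\<close> is a finite union of images of compact sets under the
  injections.\<close>

lemma compactin_sum_topology_iff:
  "compactin (sum_topology X I) K \<longleftrightarrow>
     K \<subseteq> Sigma I (topspace \<circ> X) \<and> finite (fst ` K) \<and> (\<forall>i\<in>I. compactin (X i) {x. (i, x) \<in> K})"
proof (intro iffI conjI ballI)
  assume K: "compactin (sum_topology X I) K"
  then show sub: "K \<subseteq> Sigma I (topspace \<circ> X)"
    using compactin_subset_topspace by fastforce
  define \<U> where "\<U> = (\<lambda>i. Pair i ` topspace (X i)) ` I"
  have "openin (sum_topology X I) U" if "U \<in> \<U>" for U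
    using that open_map_component_injection[of _ I X] by (auto simp: \<U>_def open_map_def)
  moreover have "K \<subseteq> \<Union>\<U>"
    using sub by (fastforce simp: \<U>_def)
  ultimately have "\<exists>\<F>. finite \<F> \<and> \<F> \<subseteq> \<U> \<and> K \<subseteq> \<Union>\<F>"
    by (rule compactinD[OF K])
  then obtain \<F> where \<F>: "finite \<F>" "\<F> \<subseteq> \<U>" "K \<subseteq> \<Union>\<F>"
    by (elim exE conjE)
  then obtain J where "finite J" "\<F> = (\<lambda>i. Pair i ` topspace (X i)) ` J"
    unfolding \<U>_def by (meson finite_subset_image)
  then have "fst ` K \<subseteq> J"
    using \<F>(3) by auto
  then show "finite (fst ` K)"
    using \<open>finite J\<close> finite_subset by blast
  fix i assume i: "i \<in> I"
  have "closedin (sum_topology X I) (Pair i ` topspace (X i))"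
    using closed_map_component_injection[OF i, of X] closedin_topspace unfolding closed_map_def by blast
  then have "compactin (sum_topology X I) (K \<inter> Pair i ` topspace (X i))"
    by (rule compact_Int_closedin[OF K])
  moreover have "K \<inter> Pair i ` topspace (X i) = Pair i ` {x. (i, x) \<in> K}"
    using sub by auto
  \<comment> \<open>The injection \<open>Pair i\<close> is a homeomorphism onto this subspace, so
    compactness there transports back to \<open>X i\<close>.\<close>
  ultimately have "compactin (subtopology (sum_topology X I) (Pair i ` topspace (X i)))
      (Pair i ` {x. (i, x) \<in> K})"
    unfolding compactin_subtopology by (metis inf_le2)
  moreover have "{x. (i, x) \<in> K} \<subseteq> topspace (X i)"
    using sub by auto
  ultimately show "compactin (X i) {x. (i, x) \<in> K}"
    using embedding_map_component_injection[OF i, of X]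
    by (simp add: embedding_map_def homeomorphic_map_compactness)
next
  assume K: "K \<subseteq> Sigma I (topspace \<circ> X) \<and> finite (fst ` K) \<and>
    (\<forall>i\<in>I. compactin (X i) {x. (i, x) \<in> K})"
  then have "fst ` K \<subseteq> I"
    by auto
  have "compactin (sum_topology X I) (Pair i ` {x. (i, x) \<in> K})" if "i \<in> fst ` K" for i
  proof -
    have "i \<in> I"
      using that \<open>fst ` K \<subseteq> I\<close> by blast
    then show ?thesis
      using K by (intro image_compactin[OF _ continuous_map_component_injection]) auto
  qed
  then have "compactin (sum_topology X I) (\<Union>i\<in>fst ` K. Pair i ` {x. (i, x) \<in> K})"
    using K by (intro compactin_Union) auto
  moreover have "(\<Union>i\<in>fst ` K. Pair i ` {x. (i, x) \<in> K}) = K"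
    by force
  ultimately show "compactin (sum_topology X I) K"
    by simp
qed

text \<open>A set that is an intersection of open sets is also the intersection of all its open
  neighbourhoods, so saturation can be tested one outside point at a time.\<close>

lemma saturatedin_iff:
  "saturatedin X K \<longleftrightarrow> K \<subseteq> topspace X \<and> (\<forall>x\<in>topspace X - K. \<exists>U. openin X U \<and> K \<subseteq> U \<and> x \<notin> U)"
    (is "?lhs \<longleftrightarrow> ?rhs")
proof
  assume ?lhs
  then obtain \<U> where "\<forall>U\<in>\<U>. openin X U" "K = topspace X \<inter> \<Inter>\<U>"
    by (auto simp: saturatedin_def)
  then show ?rhs
    by blast
next
  assume ?rhs
  then have "K = topspace X \<inter> \<Inter>(open_nhds_of X K)"
    unfolding open_nhds_of_def by blast
  then show ?lhs
    unfolding saturatedin_def by (intro exI[of _ "open_nhds_of X K"]) (simp add: open_nhds_of_def)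
qed

lemma saturatedin_sum_topology:
  assumes K: "\<And>i. i \<in> I \<Longrightarrow> saturatedin (X i) (K i)"
  shows "saturatedin (sum_topology X I) (Sigma I K)"
  unfolding saturatedin_iff
proof (intro conjI ballI)
  have sub: "x \<in> topspace (X i)" if "i \<in> I" "x \<in> K i" for i x
    using K[OF that(1)] that(2) by (auto simp: saturatedin_def)
  then show "Sigma I K \<subseteq> topspace (sum_topology X I)"
    by auto
  fix p assume "p \<in> topspace (sum_topology X I) - Sigma I K"
  moreover obtain i x where "p = (i, x)"
    by (cases p)
  ultimately have p: "p = (i, x)" "i \<in> I" "x \<in> topspace (X i)" "x \<notin> K i"
    by auto
  then obtain U where U: "openin (X i) U" "K i \<subseteq> U" "x \<notin> U"
    using K[OF p(2)] unfolding saturatedin_iff by blast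
  \<comment> \<open>The separating set is \<open>U\<close> in the summand of the excluded point and
    the whole space in every other summand.\<close>
  have "openin (sum_topology X I) (Sigma I ((topspace \<circ> X)(i := U)))"
    using U(1) by (simp add: openin_disjoint_union)
  moreover have "Sigma I K \<subseteq> Sigma I ((topspace \<circ> X)(i := U))"
    using sub U(2) by auto
  ultimately show "\<exists>V. openin (sum_topology X I) V \<and> Sigma I K \<subseteq> V \<and> p \<notin> V"
    using p(1) U(3) by (intro exI[of _ "Sigma I ((topspace \<circ> X)(i := U))"]) auto
qed

section \<open>Consonance of topological sums\<close>

lemma homeomorphic_map_sum_opens_map:
  "homeomorphic_map (scott_opens (sum_topology X I))
     (scott_topology (\<Pi>\<^sub>E i\<in>I. opens_of (X i)) (coordinatewise_subset I)) (sum_opens_map I)"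
  by (intro homeomorphic_map_scott_topology bij_betw_sum_opens_map sum_opens_map_le_iff) auto

text \<open>Both sides are \<open>undefined\<close> outside \<open>I\<close>, so it suffices to
  compare them on \<open>I\<close>.\<close>

lemma sum_opens_map_Sigma:
  assumes "F \<in> Pi\<^sub>E I A"
  shows "sum_opens_map I (Sigma I F) = F"
  using assms by (auto simp: sum_opens_map_def PiE_iff extensional_def fun_eq_iff)

text \<open>One inclusion holds for all products of posets. For the other, a Scott-open
  \<open>G\<close> pulls back to a Scott-open family of open sets of the sum, and consonance
  provides compact sets whose neighbourhoods translate into basic boxes inside
  \<open>G\<close>.\<close>

lemma scott_PiE_eq_product_if_consonant:
  fixes X :: "'i \<Rightarrow> 'a topology"
  assumes "consonant_space (sum_topology X I)"
  shows "scott_topology (\<Pi>\<^sub>E i\<in>I. opens_of (X i)) (coordinatewise_subset I) =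
    product_topology (\<lambda>i. scott_opens (X i)) I" (is "?S = ?T")
  unfolding topology_eq
proof (intro allI iffI)
  fix G assume "openin ?T G"
  then show "openin ?S G"
    using openin_scott_topology_PiE_if_openin_product[where le = "\<lambda>i. (\<subseteq>)" and P = "\<lambda>i. opens_of (X i)"]
    by (simp add: coordinatewise_subset_def[abs_def])
next
  fix G assume G: "openin ?S G"
  define \<H> where "\<H> = {U. openin (sum_topology X I) U \<and> sum_opens_map I U \<in> G}"
  have \<H>: "openin (scott_opens (sum_topology X I)) \<H>"
    using openin_continuous_map_preimage[OF
        homeomorphic_imp_continuous_map[OF homeomorphic_map_sum_opens_map] G]
    by (simp add: \<H>_def)
  show "openin ?T G"
    unfolding openin_product_topology_alt
  proof
    fix F assume F: "F \<in> G"
    then have F': "F \<in> (\<Pi>\<^sub>E i\<in>I. opens_of (X i))"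
      using openin_subset[OF G] by auto
    have "Sigma I F \<in> \<H>"
      using F F' by (auto simp: \<H>_def sum_opens_map_Sigma[OF F'] openin_disjoint_union)
    then obtain K where K: "compactin (sum_topology X I) K" "K \<subseteq> Sigma I F"
        "open_nhds_of (sum_topology X I) K \<subseteq> \<H>"
      using assms \<H> unfolding consonant_space_def by blast
    \<comment> \<open>The box with these sides corresponds under \<open>sum_opens_map\<close> to the
      open neighbourhoods of \<open>K\<close>.\<close>
    define W where "W i = open_nhds_of (X i) {x. (i, x) \<in> K}" for i
    have cpt: "K \<subseteq> Sigma I (topspace \<circ> X)" "finite (fst ` K)"
        "\<forall>i\<in>I. compactin (X i) {x. (i, x) \<in> K}"
      using K(1) by (simp_all add: compactin_sum_topology_iff)
    \<comment> \<open>A summand that \<open>K\<close> misses has empty slice, which every open set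
      contains; so only the finitely many summands met by \<open>K\<close> can give proper
      sides.\<close>
    have "W i = opens_of (X i)" if "i \<notin> fst ` K" for i
      using that by (force simp: W_def open_nhds_of_def)
    then have "{i \<in> I. W i \<noteq> opens_of (X i)} \<subseteq> fst ` K"
      by auto
    then have "finite {i \<in> I. W i \<noteq> topspace (scott_opens (X i))}"
      using cpt(2) finite_subset by auto
    moreover have "\<forall>i\<in>I. openin (scott_opens (X i)) (W i)"
      using cpt(3) by (simp add: W_def scott_open_open_nhds_of)
    moreover have "F \<in> Pi\<^sub>E I W"
      using F' K(2) by (auto simp: PiE_iff W_def open_nhds_of_def)
    moreover have "Pi\<^sub>E I W \<subseteq> G"
    proof
      fix V assume V: "V \<in> Pi\<^sub>E I W"
      then have "openin (sum_topology X I) (Sigma I V)"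
        by (auto simp: openin_disjoint_union W_def open_nhds_of_def)
      moreover have "K \<subseteq> Sigma I V"
        using V cpt(1) by (fastforce simp: W_def open_nhds_of_def)
      ultimately have "Sigma I V \<in> \<H>"
        using K(3) by (auto simp: open_nhds_of_def)
      then show "V \<in> G"
        by (simp add: \<H>_def sum_opens_map_Sigma[OF V])
    qed
    ultimately show "\<exists>W. finite {i \<in> I. W i \<noteq> topspace (scott_opens (X i))} \<and>
        (\<forall>i\<in>I. openin (scott_opens (X i)) (W i)) \<and> F \<in> Pi\<^sub>E I W \<and> Pi\<^sub>E I W \<subseteq> G"
      by blast
  qed
qed

text \<open>A basic box around the image of \<open>U\<close> has finitely many proper sides.
  Consonance of those summands shrinks each such side to the neighbourhoods of a compact set, and
  these finitely many compact sets have compact union in the sum.\<close>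

lemma consonant_sum_if_scott_PiE_eq_product:
  fixes X :: "'i \<Rightarrow> 'a topology"
  assumes cons: "\<And>i. i \<in> I \<Longrightarrow> consonant_space (X i)"
    and eq: "scott_topology (\<Pi>\<^sub>E i\<in>I. opens_of (X i)) (coordinatewise_subset I) =
      product_topology (\<lambda>i. scott_opens (X i)) I"
  shows "consonant_space (sum_topology X I)"
  unfolding consonant_space_def
proof (intro allI impI ballI)
  fix \<H> U assume \<H>: "openin (scott_opens (sum_topology X I)) \<H>" and U: "U \<in> \<H>"
  have U_open: "openin (sum_topology X I) U"
    using openin_subset[OF \<H>] U by auto
  \<comment> \<open>The image of \<open>\<H>\<close> is Scott open for the product order; the
    assumed equality makes it open in the product topology, so that a basic box exists.\<close>
  have "openin (product_topology (\<lambda>i. scott_opens (X i)) I) (sum_opens_map I ` \<H>)"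
    using \<H> homeomorphic_map_openness_eq[OF homeomorphic_map_sum_opens_map, of X I] eq by auto
  moreover have "sum_opens_map I U \<in> sum_opens_map I ` \<H>"
    using U by blast
  ultimately obtain W where fin: "finite {i \<in> I. W i \<noteq> opens_of (X i)}"
    and W: "\<forall>i\<in>I. openin (scott_opens (X i)) (W i)"
    and UW: "sum_opens_map I U \<in> Pi\<^sub>E I W" and WH: "Pi\<^sub>E I W \<subseteq> sum_opens_map I ` \<H>"
    unfolding openin_product_topology_alt topspace_scott_topology by meson
  \<comment> \<open>Consonance alone could give nonempty sets on infinitely many summands. Choosing
    the empty set on every full side keeps \<open>Sigma I K\<close> compact.\<close>
  have "\<exists>K. compactin (X i) K \<and> saturatedin (X i) K \<and> K \<subseteq> {x. (i, x) \<in> U} \<and>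
      open_nhds_of (X i) K \<subseteq> W i \<and> (W i = opens_of (X i) \<longrightarrow> K = {})" if i: "i \<in> I" for i
  proof (cases "W i = opens_of (X i)")
    case True
    have "saturatedin (X i) {}"
      by (auto simp: saturatedin_iff)
    with True show ?thesis
      by (intro exI[of _ "{}"]) (auto simp: open_nhds_of_def)
  next
    case False
    have "{x. (i, x) \<in> U} \<in> W i"
      using UW i by (auto simp: sum_opens_map_def PiE_iff)
    with False show ?thesis
      using cons[OF i] W i unfolding consonant_space_def by meson
  qed
  then obtain K where K: "\<And>i. i \<in> I \<Longrightarrow> compactin (X i) (K i) \<and> saturatedin (X i) (K i) \<and>
      K i \<subseteq> {x. (i, x) \<in> U} \<and> open_nhds_of (X i) (K i) \<subseteq> W i \<and> (W i = opens_of (X i) \<longrightarrow> K i = {})"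
    by metis
  have KU: "Sigma I K \<subseteq> U"
    using K by blast
  have "fst ` Sigma I K \<subseteq> {i \<in> I. W i \<noteq> opens_of (X i)}"
    using K by fastforce
  then have "finite (fst ` Sigma I K)"
    using fin finite_subset by blast
  moreover have "Sigma I K \<subseteq> Sigma I (topspace \<circ> X)"
    using KU openin_subset[OF U_open] by auto
  moreover have "compactin (X i) {x. (i, x) \<in> Sigma I K}" if "i \<in> I" for i
    using K[OF that] that by simp
  ultimately have "compactin (sum_topology X I) (Sigma I K)"
    by (simp add: compactin_sum_topology_iff)
  moreover have "saturatedin (sum_topology X I) (Sigma I K)"
    using K by (intro saturatedin_sum_topology) auto
  moreover have "V \<in> \<H>" if V: "V \<in> open_nhds_of (sum_topology X I) (Sigma I K)" for V
  proof -
    have V': "openin (sum_topology X I) V" "Sigma I K \<subseteq> V"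
      using V by (auto simp: open_nhds_of_def)
    have "{x. (i, x) \<in> V} \<in> W i" if "i \<in> I" for i
    proof -
      have "{x. (i, x) \<in> V} \<in> open_nhds_of (X i) (K i)"
        using V' that by (auto simp: open_nhds_of_def openin_sum_topology)
      then show ?thesis
        using K[OF that] by blast
    qed
    then have "sum_opens_map I V \<in> Pi\<^sub>E I W"
      by (auto simp: sum_opens_map_def)
    then obtain V0 where V0: "V0 \<in> \<H>" "sum_opens_map I V = sum_opens_map I V0"
      using WH by blast
    moreover have "openin (sum_topology X I) V0"
      using V0(1) openin_subset[OF \<H>] by auto
    \<comment> \<open>The box lies in the image of \<open>\<H>\<close>, so only equality of images
      is known; injectivity on open sets recovers \<open>V\<close> itself.\<close>
    ultimately have "V = V0"
      using bij_betw_imp_inj_on[OF bij_betw_sum_opens_map[of I X]] V'(1) by (auto dest: inj_onD)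
    then show ?thesis
      using V0(1) by simp
  qed
  ultimately show "\<exists>K. compactin (sum_topology X I) K \<and> saturatedin (sum_topology X I) K \<and> K \<subseteq> U \<and>
      U \<in> open_nhds_of (sum_topology X I) K \<and> open_nhds_of (sum_topology X I) K \<subseteq> \<H>"
    using KU U_open by (intro exI[of _ "Sigma I K"]) (auto simp: open_nhds_of_def)
qed

theorem theorem3p1:
  fixes X :: "'i \<Rightarrow> 'a topology" and I :: "'i set"
  shows
    "(consonant_space (sum_topology X I) \<longrightarrow>
        homeomorphic_map (scott_opens (sum_topology X I))
          (product_topology (\<lambda>i. scott_opens (X i)) I) (sum_opens_map I) \<and>
        scott_topology (\<Pi>\<^sub>E i\<in>I. opens_of (X i)) (coordinatewise_subset I) =
          product_topology (\<lambda>i. scott_opens (X i)) I)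
     \<and>
     (homeomorphic_map (scott_opens (sum_topology X I))
          (product_topology (\<lambda>i. scott_opens (X i)) I) (sum_opens_map I) \<longleftrightarrow>
        scott_topology (\<Pi>\<^sub>E i\<in>I. opens_of (X i)) (coordinatewise_subset I) =
          product_topology (\<lambda>i. scott_opens (X i)) I)
     \<and>
     ((\<forall>i\<in>I. consonant_space (X i)) \<and>
        scott_topology (\<Pi>\<^sub>E i\<in>I. opens_of (X i)) (coordinatewise_subset I) =
          product_topology (\<lambda>i. scott_opens (X i)) I \<longrightarrow>
      consonant_space (sum_topology X I))
     \<and>
     ((\<forall>i\<in>I. consonant_space (X i)) \<longrightarrow>
      (scott_topology (\<Pi>\<^sub>E i\<in>I. opens_of (X i)) (coordinatewise_subset I) =
          product_topology (\<lambda>i. scott_opens (X i)) I \<longleftrightarrow>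
       consonant_space (sum_topology X I)))"
proof -
  let ?eq = "scott_topology (\<Pi>\<^sub>E i\<in>I. opens_of (X i)) (coordinatewise_subset I) =
    product_topology (\<lambda>i. scott_opens (X i)) I"
  have "?eq" if "consonant_space (sum_topology X I)"
    using that by (rule scott_PiE_eq_product_if_consonant)
  moreover have "consonant_space (sum_topology X I)" if "\<forall>i\<in>I. consonant_space (X i)" "?eq"
    using that by (intro consonant_sum_if_scott_PiE_eq_product) auto
  \<comment> \<open>The map is always a homeomorphism onto the Scott topology of the product order,
    so being one onto the product topology means that the two topologies agree.\<close>
  moreover have "homeomorphic_map (scott_opens (sum_topology X I))
      (product_topology (\<lambda>i. scott_opens (X i)) I) (sum_opens_map I) \<longleftrightarrow> ?eq"
    by (rule homeomorphic_map_same_domain_iff[OF homeomorphic_map_sum_opens_map])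
  ultimately show ?thesis
    by argo
qed

end
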